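(* Let $n,k\in\mathbb{N}$ and let $B_1,\dots,B_k$ be compact convex subsets of $\mathbb{R}^n$. Define $v:\mathbb{R}_+^k\to\mathbb{R}$ by $v(x)=\left|\sum_{i=1}^k x_iB_i\right|$. Then $v$ is $m$-supermodular for every positive integer $m$.
   Context: $|\cdot|$ denotes $n$-dimensional Lebesgue measure and $\sum x_iB_i$ is the Minkowski sum $\{\sum x_i b_i: b_i\in B_i\}$. For $x,y\in\mathbb{R}_+^k$, $x\vee y$ and $x\wedge y$ denote the componentwise maximum and minimum. A function $f:\mathbb{R}_+^k\to\mathbb{R}$ is called $m$-supermodular if for every $x_0\in\mathbb{R}_+^k$ and every $x_1,\dots,x_m\in\mathbb{R}_+^k$ with mutually disjoint supports (i.e. $x_i\wedge x_j=0$ for all $1\le i<j\le m$) one has $\sum_{I\subset[m]}(-1)^{m-|I|}f\left(x_0\vee\bigvee_{i\in I}x_i\right)\ge 0$, where $[m]=\{1,\dots,m\}$ and the empty join is omitted. *)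

theory Defs
  imports "HOL-Analysis.Analysis"
begin

text \<open>Points of R_+^k are represented as functions x :: nat => real, of which only the
  coordinates j < k matter; nonnegativity is required on those coordinates.\<close>

definition nonneg_vec :: "nat \<Rightarrow> (nat \<Rightarrow> real) \<Rightarrow> bool" where
  "nonneg_vec k x \<longleftrightarrow> (\<forall>j<k. 0 \<le> x j)"

definition join_vec :: "(nat \<Rightarrow> real) \<Rightarrow> (nat \<Rightarrow> nat \<Rightarrow> real) \<Rightarrow> nat set \<Rightarrow> (nat \<Rightarrow> real)" where
  "join_vec x0 xs I = (\<lambda>j. Max (insert (x0 j) ((\<lambda>i. xs i j) ` I)))"

definition m_supermodular :: "nat \<Rightarrow> nat \<Rightarrow> ((nat \<Rightarrow> real) \<Rightarrow> real) \<Rightarrow> bool" where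
  "m_supermodular k m f \<longleftrightarrow>
     (\<forall>x0 xs. nonneg_vec k x0 \<longrightarrow> (\<forall>i\<in>{1..m}. nonneg_vec k (xs i)) \<longrightarrow>
        (\<forall>i\<in>{1..m}. \<forall>l\<in>{1..m}. i < l \<longrightarrow> (\<forall>j<k. min (xs i j) (xs l j) = 0)) \<longrightarrow>
        0 \<le> (\<Sum>I\<in>Pow {1..m}. (-1::real) ^ (m - card I) * f (join_vec x0 xs I)))"

definition minkowski_comb :: "nat \<Rightarrow> (nat \<Rightarrow> real) \<Rightarrow> (nat \<Rightarrow> 'a::real_vector set) \<Rightarrow> 'a set" where
  "minkowski_comb k x B = {(\<Sum>i<k. x i *\<^sub>R b i) | b. \<forall>i<k. b i \<in> B i}"

end

theory Submission
  imports Defs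
begin

text \<open>
  On the coordinates the join of \<open>x\<^sub>0\<close> with the \<open>x\<^sub>i\<close>, \<open>i \<in> I\<close>, equals \<open>x\<^sub>0\<close> plus the sum of the
  positive parts of \<open>x\<^sub>i - x\<^sub>0\<close>, because the supports are disjoint. By convexity of the \<open>B\<^sub>j\<close> the
  claim is therefore that the mixed difference of \<open>I \<mapsto> \<bar>C\<^sub>0 + \<Sum>\<^sub>i C\<^sub>i\<bar>\<close> is nonnegative
  for compact convex sets \<open>C\<^sub>i\<close>, and by outer approximation these may be taken to be full-dimensional
  polytopes, \<open>C\<^sub>i = conv P\<^sub>i\<close> with \<open>P\<^sub>i\<close> finite.

  The gradient of the convex function \<open>y \<mapsto> ln (\<Sum>\<^sub>p exp (p \<bullet> y))\<close>, \<open>p \<in> P\<^sub>i\<close>, is a weighted mean of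
  \<open>P\<^sub>i\<close> (Gromov's form of the moment map). The sum of these gradients is an injective map whose image
  lies between the sum of the \<open>C\<^sub>i\<close> and its interior, so the volume of the sum is the integral of the
  determinant of a sum of Hessians. Each Hessian is a sum of rank one matrices \<open>v v\<^sup>T\<close>, and
  by Cauchy-Binet the determinant of such a sum over an index set \<open>J\<close> is a sum of nonnegative terms
  indexed by the functions from the coordinates to \<open>J\<close>. The alternating sum over \<open>I\<close> keeps
  only the functions that meet every block of indices, hence is nonnegative pointwise.
\<close>

section \<open>Alternating sums of determinants\<close>

text \<open>Cauchy-Binet for a sum of rank one matrices, with functions in place of subsets of
  \<open>S\<close>: a non-injective \<open>f\<close> repeats a row and contributes zero, and each
  subset of size \<open>CARD('n)\<close> is counted once for each of its orderings, whence the
  factorial.\<close>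

lemma det_sum_outer_products:
  fixes v :: "'j \<Rightarrow> real^'n"
  assumes "finite S"
  shows "fact CARD('n) * det (\<chi> r c. \<Sum>j\<in>S. v j $ r * v j $ c) =
    (\<Sum>f\<in>UNIV \<rightarrow>\<^sub>E S. (det (\<chi> r. v (f r)))\<^sup>2)"
proof -
  let ?F = "(UNIV :: 'n set) \<rightarrow>\<^sub>E S" and ?Q = "{q. q permutes (UNIV :: 'n set)}"
  define D where "D f = det (\<chi> r. v (f r))" for f :: "'n \<Rightarrow> 'j"
  define g where "g f = (\<Prod>r\<in>UNIV. v (f r) $ r) * D f" for f
  have "det (\<chi> r c. \<Sum>j\<in>S. v j $ r * v j $ c) =
      (\<Sum>p\<in>?Q. of_int (sign p) * (\<Sum>f\<in>?F. \<Prod>r\<in>UNIV. v (f r) $ r * v (f r) $ p r))"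
    unfolding det_def by (simp add: prod_sum_PiE assms)
  \<comment> \<open>For fixed \<open>f\<close> the sum over \<open>p\<close> is the Leibniz
    expansion of \<open>D f\<close>; the diagonal factors do not involve \<open>p\<close>.\<close>
  also have "\<dots> = (\<Sum>f\<in>?F. g f)"
    unfolding sum_distrib_left
    by (subst sum.swap) (simp add: g_def D_def det_def prod.distrib sum_distrib_left mult_ac)
  finally have det_eq: "det (\<chi> r c. \<Sum>j\<in>S. v j $ r * v j $ c) = (\<Sum>f\<in>?F. g f)" .
  \<comment> \<open>Permuting the arguments of \<open>f\<close> and averaging turns each term into a square.\<close>
  have shift: "(\<Sum>f\<in>?F. g f) = (\<Sum>f\<in>?F. of_int (sign q) * (\<Prod>r\<in>UNIV. v (f (q r)) $ r) * D f)"
    if q: "q permutes UNIV" for q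
  proof -
    have "bij_betw (\<lambda>f. f \<circ> q) ?F ?F"
    proof (rule bij_betwI[where g = "\<lambda>f. f \<circ> inv q"])
      show "(\<lambda>f. f \<circ> q) \<in> ?F \<rightarrow> ?F" "(\<lambda>f. f \<circ> inv q) \<in> ?F \<rightarrow> ?F"
        by (auto simp: PiE_def Pi_def)
    qed (simp_all add: o_assoc[symmetric] permutes_inv_o[OF q])
    then have "(\<Sum>f\<in>?F. g f) = (\<Sum>f\<in>?F. g (f \<circ> q))"
      by (rule sum.reindex_bij_betw[symmetric])
    moreover have "D (f \<circ> q) = of_int (sign q) * D f" for f
      using det_permute_rows[OF q, of "\<chi> r. v (f r)"] by (simp add: D_def)
    ultimately show ?thesis
      by (simp add: g_def mult_ac)
  qed
  have column_expansion: "(\<Sum>q\<in>?Q. of_int (sign q) * (\<Prod>r\<in>UNIV. v (f (q r)) $ r)) = D f" for f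
    using det_transpose[of "\<chi> r. v (f r)"] by (simp add: D_def det_def transpose_def)
  have "fact CARD('n) * (\<Sum>f\<in>?F. g f) = (\<Sum>q\<in>?Q. \<Sum>f\<in>?F. g f)"
    by (simp add: card_permutations)
  also have "\<dots> = (\<Sum>q\<in>?Q. \<Sum>f\<in>?F. of_int (sign q) * (\<Prod>r\<in>UNIV. v (f (q r)) $ r) * D f)"
    by (intro sum.cong refl shift) simp
  also have "\<dots> = (\<Sum>f\<in>?F. D f * D f)"
    by (subst sum.swap) (simp add: column_expansion flip: sum_distrib_right)
  finally show ?thesis
    by (simp add: det_eq D_def power2_eq_square)
qed

text \<open>Moebius inversion on the subset lattice: the inner sum accumulates \<open>h\<close> over
  the subsets of \<open>I\<close>, so the signed sum returns \<open>h M\<close>, the part of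
  \<open>d\<close> carried by those \<open>f\<close> with \<open>T f = M\<close>.\<close>

lemma alternating_sum_nonneg:
  fixes d :: "'b \<Rightarrow> real"
  assumes "finite M" "finite F" and d: "\<And>f. f \<in> F \<Longrightarrow> 0 \<le> d f"
  shows "0 \<le> (\<Sum>I\<in>Pow M. (-1) ^ (card M - card I) * (\<Sum>f | f \<in> F \<and> T f \<subseteq> I. d f))"
proof -
  define h where "h N = (\<Sum>f | f \<in> F \<and> T f = N. d f)" for N
  have "(\<Sum>f | f \<in> F \<and> T f \<subseteq> I. d f) = sum h (Pow I)" if "finite I" for I
    unfolding h_def
    by (subst sum.group[symmetric, where T = "Pow I" and g = T]) (use assms that in \<open>auto intro!: sum.cong\<close>)
  from inclusion_exclusion_mobius[where g = "\<lambda>I. \<Sum>f | f \<in> F \<and> T f \<subseteq> I. d f", OF this \<open>finite M\<close>]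
  have "(\<Sum>I\<in>Pow M. (-1) ^ (card M - card I) * (\<Sum>f | f \<in> F \<and> T f \<subseteq> I. d f)) = h M"
    by simp
  also have "\<dots> \<ge> 0"
    unfolding h_def using d by (auto intro: sum_nonneg)
  finally show ?thesis .
qed

lemma alternating_det_nonneg:
  fixes v :: "'i \<times> 'b \<Rightarrow> real^'n"
  assumes "finite M" "a \<notin> M" and P: "\<And>i. i \<in> insert a M \<Longrightarrow> finite (P i)"
  shows "0 \<le> (\<Sum>I\<in>Pow M. (-1) ^ (card M - card I) *
    det (\<chi> r c. \<Sum>j\<in>Sigma (insert a I) P. v j $ r * v j $ c))"
proof -
  let ?J = "\<lambda>I. Sigma (insert a I) P"
  define F where "F = ((UNIV :: 'n set) \<rightarrow>\<^sub>E ?J M)"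
  \<comment> \<open>The block \<open>a\<close> belongs to every index set, so only the blocks from
    \<open>M\<close> that \<open>f\<close> meets are recorded.\<close>
  define T where "T f = fst ` range f - {a}" for f :: "'n \<Rightarrow> 'i \<times> 'b"
  define d where "d f = (det (\<chi> r. v (f r)))\<^sup>2 / fact CARD('n)" for f :: "'n \<Rightarrow> 'i \<times> 'b"
  have "det (\<chi> r c. \<Sum>j\<in>?J I. v j $ r * v j $ c) = (\<Sum>f | f \<in> F \<and> T f \<subseteq> I. d f)" if "I \<subseteq> M" for I
  proof -
    have "finite (?J I)"
      using assms that by (intro finite_SigmaI) (auto dest: finite_subset)
    from det_sum_outer_products[OF this, of v]
    have "det (\<chi> r c. \<Sum>j\<in>?J I. v j $ r * v j $ c) = (\<Sum>f\<in>UNIV \<rightarrow>\<^sub>E ?J I. d f)"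
      by (simp add: d_def field_simps flip: sum_divide_distrib)
    also have "(UNIV \<rightarrow>\<^sub>E ?J I) = {f. f \<in> F \<and> T f \<subseteq> I}"
    proof -
      have "f \<in> F \<and> T f \<subseteq> I \<longleftrightarrow> (\<forall>r. f r \<in> ?J I)" for f
      proof
        assume "f \<in> F \<and> T f \<subseteq> I"
        then have F: "\<And>r. f r \<in> ?J M" and T: "\<And>r. fst (f r) \<in> insert a I"
          by (auto simp: F_def T_def)
        show "\<forall>r. f r \<in> ?J I"
          using F T by (metis SigmaE SigmaI fst_conv)
      next
        assume *: "\<forall>r. f r \<in> ?J I"
        then have "fst (f r) \<in> insert a I" for r
          by (metis SigmaE fst_conv)
        moreover have "f r \<in> ?J M" for r
          using * that by (metis SigmaE SigmaI insert_mono subsetD)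
        ultimately show "f \<in> F \<and> T f \<subseteq> I"
          unfolding F_def T_def by blast
      qed
      then show ?thesis
        by (auto simp: PiE_iff)
    qed
    finally show ?thesis .
  qed
  then have "(\<Sum>I\<in>Pow M. (-1) ^ (card M - card I) * det (\<chi> r c. \<Sum>j\<in>?J I. v j $ r * v j $ c)) =
      (\<Sum>I\<in>Pow M. (-1) ^ (card M - card I) * (\<Sum>f | f \<in> F \<and> T f \<subseteq> I. d f))"
    by (intro sum.cong) auto
  moreover have "finite F"
    unfolding F_def using assms by (intro finite_PiE finite_SigmaI) auto
  ultimately show ?thesis
    using alternating_sum_nonneg[OF \<open>finite M\<close>, of F d T] by (simp add: d_def)
qed

section \<open>The moment map of a family of polytopes\<close>

text \<open>The softmax distribution: the uniform distribution on \<open>P\<close> tilted by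
  \<open>exp (p \<bullet> y)\<close>. Its mean is the gradient of
  \<open>log_partition\<close>.\<close>

definition gibbs_weight :: "'a::euclidean_space set \<Rightarrow> 'a \<Rightarrow> 'a \<Rightarrow> real" where
  "gibbs_weight P y p = exp (p \<bullet> y) / (\<Sum>q\<in>P. exp (q \<bullet> y))"

definition gibbs_mean :: "'a::euclidean_space set \<Rightarrow> 'a \<Rightarrow> 'a" where
  "gibbs_mean P y = (\<Sum>p\<in>P. gibbs_weight P y p *\<^sub>R p)"

definition log_partition :: "'a::euclidean_space set \<Rightarrow> 'a \<Rightarrow> real" where
  "log_partition P y = ln (\<Sum>p\<in>P. exp (p \<bullet> y))"

lemma partition_pos:
  fixes P :: "'a::euclidean_space set"
  assumes "finite P" "P \<noteq> {}"
  shows "0 < (\<Sum>p\<in>P. exp (p \<bullet> y))"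
  using assms by (intro sum_pos) auto

lemma gibbs_weight_pos:
  assumes "finite P" "P \<noteq> {}"
  shows "0 < gibbs_weight P y p"
  using partition_pos[OF assms] by (simp add: gibbs_weight_def)

lemma sum_gibbs_weight:
  assumes "finite P" "P \<noteq> {}"
  shows "(\<Sum>p\<in>P. gibbs_weight P y p) = 1"
  using partition_pos[OF assms, of y] by (simp add: gibbs_weight_def flip: sum_divide_distrib)

lemma gibbs_mean_in_hull:
  assumes "finite P" "P \<noteq> {}"
  shows "gibbs_mean P y \<in> convex hull P"
  unfolding gibbs_mean_def
  using assms gibbs_weight_pos[OF assms] sum_gibbs_weight[OF assms]
  by (intro convex_sum) (auto intro: hull_inc less_imp_le)

text \<open>Expresses the directional derivative of the partition function through the mean, which
  simplifies the derivatives below.\<close>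

lemma sum_partition_inner:
  assumes "finite P" "P \<noteq> {}"
  shows "(\<Sum>p\<in>P. (p \<bullet> h) * exp (p \<bullet> y)) = (\<Sum>p\<in>P. exp (p \<bullet> y)) * (gibbs_mean P y \<bullet> h)"
  using partition_pos[OF assms, of y]
  by (simp add: gibbs_mean_def gibbs_weight_def inner_sum_left mult_ac flip: sum_divide_distrib)

lemma log_partition_has_derivative:
  assumes "finite P" "P \<noteq> {}"
  shows "(log_partition P has_derivative (\<lambda>h. gibbs_mean P y \<bullet> h)) (at y)"
  unfolding log_partition_def
  using partition_pos[OF assms, of y]
  by (auto intro!: derivative_eq_intros simp: sum_partition_inner[OF assms])

lemma gibbs_weight_has_derivative:
  assumes "finite P" "P \<noteq> {}"
  shows "((\<lambda>y. gibbs_weight P y p) has_derivative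
    (\<lambda>h. gibbs_weight P y p * ((p - gibbs_mean P y) \<bullet> h))) (at y)"
  unfolding gibbs_weight_def
  using partition_pos[OF assms, of y]
  by (auto intro!: derivative_eq_intros simp: sum_partition_inner[OF assms] field_simps inner_diff_left)

text \<open>The derivative is the covariance of the Gibbs distribution. Differentiating the weights
  leaves the uncentred vector \<open>p\<close>; it may be replaced by its deviation from the mean
  because the weighted deviations have sum zero. This yields symmetric rank one terms.\<close>

lemma gibbs_mean_has_derivative:
  assumes "finite P" "P \<noteq> {}"
  shows "(gibbs_mean P has_derivative
    (\<lambda>h. \<Sum>p\<in>P. (gibbs_weight P y p * ((p - gibbs_mean P y) \<bullet> h)) *\<^sub>R (p - gibbs_mean P y))) (at y)"
proof -
  let ?m = "gibbs_mean P y" and ?w = "gibbs_weight P y"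
  have "(\<Sum>p\<in>P. ?w p * ((p - ?m) \<bullet> h)) = 0" for h
  proof -
    have "(\<Sum>p\<in>P. ?w p * ((p - ?m) \<bullet> h)) = (\<Sum>p\<in>P. ?w p * (p \<bullet> h)) - (\<Sum>p\<in>P. ?w p) * (?m \<bullet> h)"
      by (simp add: inner_diff_left algebra_simps sum_subtractf sum_distrib_right)
    also have "(\<Sum>p\<in>P. ?w p * (p \<bullet> h)) = ?m \<bullet> h"
      unfolding gibbs_mean_def by (simp add: inner_sum_left)
    finally show ?thesis
      by (simp add: sum_gibbs_weight[OF assms])
  qed
  then have "(\<Sum>p\<in>P. (?w p * ((p - ?m) \<bullet> h)) *\<^sub>R (p - ?m)) = (\<Sum>p\<in>P. (?w p * ((p - ?m) \<bullet> h)) *\<^sub>R p)" for h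
    by (simp add: scaleR_diff_right sum_subtractf flip: scaleR_sum_left)
  moreover have "(gibbs_mean P has_derivative (\<lambda>h. \<Sum>p\<in>P. (?w p * ((p - ?m) \<bullet> h)) *\<^sub>R p)) (at y)"
    by (subst (1) gibbs_mean_def[abs_def])
      (intro has_derivative_sum has_derivative_scaleR_left gibbs_weight_has_derivative assms)
  ultimately show ?thesis
    by simp
qed

text \<open>A sum of exponentials dominates each of its terms, which settles the vertices; a
  half-space containing them contains their hull.\<close>

lemma inner_le_log_partition:
  assumes "finite P" "x \<in> convex hull P"
  shows "x \<bullet> y \<le> log_partition P y"
proof -
  have "p \<bullet> y \<le> log_partition P y" if "p \<in> P" for p
  proof -
    have "exp (p \<bullet> y) \<le> (\<Sum>p\<in>P. exp (p \<bullet> y))"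
      using assms that by (intro member_le_sum) auto
    then show ?thesis
      unfolding log_partition_def by (subst ln_ge_iff) (use exp_gt_zero[of "p \<bullet> y"] in linarith)+
  qed
  then have "convex hull P \<subseteq> {x. y \<bullet> x \<le> log_partition P y}"
    by (intro hull_minimal convex_halfspace_le) (auto simp: inner_commute)
  then show ?thesis
    using assms by (auto simp: inner_commute)
qed

text \<open>Otherwise all points of \<open>P\<close> would lie in one hyperplane orthogonal to
  \<open>h\<close>, and so would the hull, leaving it without interior.\<close>

lemma gibbs_variance_pos:
  assumes "finite P" "interior (convex hull P) \<noteq> {}" "h \<noteq> 0"
  shows "0 < (\<Sum>p\<in>P. gibbs_weight P y p * ((p - m) \<bullet> h)\<^sup>2)"
proof -
  have "P \<noteq> {}"
    using assms by auto
  have "\<exists>p\<in>P. (p - m) \<bullet> h \<noteq> 0"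
  proof (rule ccontr)
    assume "\<not> (\<exists>p\<in>P. (p - m) \<bullet> h \<noteq> 0)"
    then have "convex hull P \<subseteq> {x. h \<bullet> x = h \<bullet> m}"
      by (intro hull_minimal convex_hyperplane) (auto simp: inner_diff_left inner_commute[of h])
    then have "interior (convex hull P) \<subseteq> {}"
      using interior_mono interior_hyperplane[OF \<open>h \<noteq> 0\<close>] by metis
    then show False
      using assms by auto
  qed
  then show ?thesis
    using gibbs_weight_pos[OF \<open>finite P\<close> \<open>P \<noteq> {}\<close>, of y] \<open>finite P\<close>
    by (auto intro!: sum_pos2 mult_pos_pos mult_nonneg_nonneg less_imp_le[OF gibbs_weight_pos])
qed

section \<open>Moment maps of several polytopes: injectivity and image\<close>

locale polytope_family =
  fixes L :: "'i set" and P :: "'i \<Rightarrow> 'a::euclidean_space set"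
  assumes finite_index: "finite L" and nonempty_index: "L \<noteq> {}"
    and finite_vertices: "\<And>i. i \<in> L \<Longrightarrow> finite (P i)"
    and full_dim: "\<And>i. i \<in> L \<Longrightarrow> interior (convex hull P i) \<noteq> {}"
begin

definition moment_map :: "'a \<Rightarrow> 'a" where
  "moment_map y = (\<Sum>i\<in>L. gibbs_mean (P i) y)"

abbreviation hull_sum :: "'a set" where
  "hull_sum \<equiv> \<Sum>i\<in>L. convex hull P i"

lemma nonempty_vertices: "i \<in> L \<Longrightarrow> P i \<noteq> {}"
  using full_dim by fastforce

lemma moment_map_has_derivative:
  "(moment_map has_derivative (\<lambda>h. \<Sum>i\<in>L. \<Sum>p\<in>P i.
    (gibbs_weight (P i) y p * ((p - gibbs_mean (P i) y) \<bullet> h)) *\<^sub>R (p - gibbs_mean (P i) y))) (at y)"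
  unfolding moment_map_def[abs_def]
  by (intro has_derivative_sum gibbs_mean_has_derivative finite_vertices nonempty_vertices)

text \<open>Gradients of strictly convex functions are strictly monotone: along the segment from
  \<open>y\<close> to \<open>z\<close> the component in direction \<open>h\<close> has a sum of
  positive variances as derivative, so its end values differ.\<close>

lemma inj_moment_map: "inj moment_map"
proof (rule injI, rule ccontr)
  fix y z :: 'a
  assume eq: "moment_map y = moment_map z" and "y \<noteq> z"
  define h where "h = z - y"
  have "h \<noteq> 0"
    using \<open>y \<noteq> z\<close> by (simp add: h_def)
  define \<phi> where "\<phi> t = moment_map (y + t *\<^sub>R h) \<bullet> h" for t :: real
  have "\<exists>D. DERIV \<phi> t :> D \<and> 0 < D" for t
  proof -
    let ?x = "y + t *\<^sub>R h"
    let ?m = "\<lambda>i. gibbs_mean (P i) ?x"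
    have "(\<phi> has_derivative (\<lambda>s. (\<Sum>i\<in>L. \<Sum>p\<in>P i.
        (gibbs_weight (P i) ?x p * ((p - ?m i) \<bullet> (s *\<^sub>R h))) *\<^sub>R (p - ?m i)) \<bullet> h)) (at t)"
      unfolding \<phi>_def
      by (rule derivative_eq_intros has_derivative_compose[OF _ moment_map_has_derivative] refl | simp)+
    also have "(\<lambda>s. (\<Sum>i\<in>L. \<Sum>p\<in>P i.
        (gibbs_weight (P i) ?x p * ((p - ?m i) \<bullet> (s *\<^sub>R h))) *\<^sub>R (p - ?m i)) \<bullet> h) =
      (*) (\<Sum>i\<in>L. \<Sum>p\<in>P i. gibbs_weight (P i) ?x p * ((p - ?m i) \<bullet> h)\<^sup>2)"
      by (simp add: fun_eq_iff inner_sum_left sum_distrib_left sum_distrib_right power2_eq_square mult_ac)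
    finally show ?thesis
      using finite_index nonempty_index
      by (auto simp: has_field_derivative_def intro!: exI sum_pos gibbs_variance_pos finite_vertices full_dim \<open>h \<noteq> 0\<close>)
  qed
  then have "\<phi> 0 < \<phi> 1"
    by (intro DERIV_pos_imp_increasing[OF zero_less_one]) blast
  then show False
    by (simp add: \<phi>_def h_def eq)
qed

lemma moment_map_in_hull_sum: "moment_map y \<in> hull_sum"
  unfolding moment_map_def
  by (subst set_sum_alt[OF finite_index])
     (auto intro!: gibbs_mean_in_hull finite_vertices nonempty_vertices)

lemma compact_hull_sum: "compact hull_sum" and convex_hull_sum: "convex hull_sum"
  \<comment> \<open>The sum of the hulls is the hull of the Minkowski sum of the vertex sets, again
    a finite set.\<close>
  unfolding convex_hull_set_sum[symmetric]
  by (auto intro!: finite_imp_compact_convex_hull finite_set_sum finite_vertices)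

lemma inner_le_sum_log_partition:
  assumes "x \<in> hull_sum"
  shows "x \<bullet> y \<le> (\<Sum>i\<in>L. log_partition (P i) y)"
proof -
  obtain s where "x = sum s L" "\<forall>i\<in>L. s i \<in> convex hull P i"
    using assms by (auto simp: set_sum_alt[OF finite_index])
  then show ?thesis
    by (auto simp: inner_sum_left intro!: sum_mono inner_le_log_partition finite_vertices)
qed

text \<open>Tilting the potential by an interior point \<open>q\<close> makes it grow at least
  linearly at infinity, so a minimum exists, and there the gradient condition reads
  \<open>moment_map y = q\<close>.\<close>

lemma interior_hull_sum_subset: "interior hull_sum \<subseteq> range moment_map"
proof
  fix q assume "q \<in> interior hull_sum"
  then obtain e where "e > 0" and e: "cball q e \<subseteq> hull_sum"
    by (meson mem_interior_cball)
  \<comment> \<open>A critical point of \<open>F\<close> is a preimage of \<open>q\<close>.\<close>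
  define F where "F y = (\<Sum>i\<in>L. log_partition (P i) y) - q \<bullet> y" for y
  have der: "(F has_derivative (\<lambda>h. (moment_map y - q) \<bullet> h)) (at y)" for y
    unfolding F_def moment_map_def inner_diff_left inner_sum_left
    by (intro derivative_intros log_partition_has_derivative finite_vertices nonempty_vertices)
  have coercive: "e * norm y \<le> F y" for y
  proof -
    \<comment> \<open>The point of \<open>cball q e\<close> farthest in direction \<open>y\<close>;
      it gives the growth rate \<open>e\<close>.\<close>
    have "q + e *\<^sub>R sgn y \<in> hull_sum"
      using e \<open>e > 0\<close> by (auto simp: dist_norm norm_sgn intro!: subsetD[OF e])
    from inner_le_sum_log_partition[OF this, of y]
    have "q \<bullet> y + e * (sgn y \<bullet> y) \<le> (\<Sum>i\<in>L. log_partition (P i) y)"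
      by (simp add: inner_add_left)
    moreover have "sgn y \<bullet> y = norm y"
      by (cases "y = 0") (simp_all add: sgn_div_norm dot_square_norm power2_eq_square)
    ultimately show ?thesis
      unfolding F_def by simp
  qed
  \<comment> \<open>Outside \<open>cball 0 R\<close> coercivity forces values above
    \<open>F 0\<close>, so a minimum over this ball is global.\<close>
  define R where "R = F 0 / e"
  have "0 \<le> F 0"
    using coercive[of 0] by simp
  then have "0 \<le> R"
    using \<open>e > 0\<close> by (simp add: R_def)
  have "continuous_on (cball 0 R) F"
    by (intro continuous_at_imp_continuous_on ballI has_derivative_continuous[OF der])
  moreover have "cball (0 :: 'a) R \<noteq> {}"
    using \<open>0 \<le> R\<close> by simp
  ultimately obtain y where y: "\<And>z. z \<in> cball 0 R \<Longrightarrow> F y \<le> F z"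
    using continuous_attains_inf[OF compact_cball, of 0 R F] by blast
  have "F y \<le> F z" for z
  proof (cases "z \<in> cball 0 R")
    case True
    then show ?thesis
      by (rule y)
  next
    case False
    then have "F 0 < e * norm z"
      using \<open>e > 0\<close> by (simp add: R_def pos_divide_less_eq mult.commute not_le)
    moreover have "F y \<le> F 0"
      using \<open>0 \<le> R\<close> by (intro y) simp
    ultimately show ?thesis
      using coercive[of z] by linarith
  qed
  then have "(\<lambda>h. (moment_map y - q) \<bullet> h) = (\<lambda>h. 0)"
    by (intro has_derivative_local_min[OF der]) (rule always_eventually, blast)
  then have "(moment_map y - q) \<bullet> (moment_map y - q) = 0"
    by (rule fun_cong)
  then have "moment_map y = q"
    by simp
  then show "q \<in> range moment_map"
    by blast
qed

end

text \<open>The square root splits the weight between both factors, so that the outer products of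
  the fluctuations sum to the Jacobian matrix of the moment map.\<close>

definition fluctuation :: "('i \<Rightarrow> 'a::euclidean_space set) \<Rightarrow> 'a \<Rightarrow> 'i \<times> 'a \<Rightarrow> 'a" where
  "fluctuation P y = (\<lambda>(i, p). sqrt (gibbs_weight (P i) y p) *\<^sub>R (p - gibbs_mean (P i) y))"

text \<open>Change of variables along the injective \<open>moment_map\<close>, whose image fills the
  Minkowski sum up to a null set.\<close>

lemma hull_sum_has_integral:
  fixes P :: "'i \<Rightarrow> (real^'n::{finite,wellorder}) set"
  assumes "polytope_family L P"
  shows "((\<lambda>y. det (\<chi> r c. \<Sum>j\<in>Sigma L P. fluctuation P y j $ r * fluctuation P y j $ c))
    has_integral measure lebesgue (\<Sum>i\<in>L. convex hull P i)) UNIV"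
proof -
  interpret polytope_family L P by fact
  define H where "H y = (\<chi> r c. \<Sum>j\<in>Sigma L P. fluctuation P y j $ r * fluctuation P y j $ c)" for y
  define f' where "f' y h = (\<Sum>i\<in>L. \<Sum>p\<in>P i.
    (gibbs_weight (P i) y p * ((p - gibbs_mean (P i) y) \<bullet> h)) *\<^sub>R (p - gibbs_mean (P i) y))" for y h
  have matrix: "matrix (f' y) = H y" for y
  proof -
    have "f' y (axis c 1) $ r = H y $ r $ c" for r c
    proof -
      have "f' y (axis c 1) $ r = (\<Sum>i\<in>L. \<Sum>p\<in>P i. gibbs_weight (P i) y p *
          (p - gibbs_mean (P i) y) $ c * (p - gibbs_mean (P i) y) $ r)"
        by (simp add: f'_def inner_axis)
      also have "\<dots> = (\<Sum>i\<in>L. \<Sum>p\<in>P i. fluctuation P y (i, p) $ r * fluctuation P y (i, p) $ c)"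
        by (intro sum.cong refl)
           (simp add: fluctuation_def less_imp_le[OF gibbs_weight_pos] finite_vertices nonempty_vertices)
      also have "\<dots> = H y $ r $ c"
        by (simp add: H_def sum.Sigma finite_index finite_vertices)
      finally show ?thesis .
    qed
    then show ?thesis
      by (simp add: matrix_def vec_eq_iff)
  qed
  have "finite (Sigma L P)"
    by (intro finite_SigmaI finite_index finite_vertices)
  \<comment> \<open>Up to a positive factor the determinant is a sum of squares, so the absolute
    value in the change of variables formula disappears.\<close>
  have "0 \<le> det (H y)" for y
  proof -
    have "0 \<le> fact CARD('n) * det (H y)"
      unfolding H_def det_sum_outer_products[OF \<open>finite (Sigma L P)\<close>] by (intro sum_nonneg) simp
    then show ?thesis
      using fact_gt_zero[where 'a = real, of "CARD('n)"] by (auto simp: zero_le_mult_iff)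
  qed
  then have det_eq: "\<bar>det (matrix (f' y))\<bar> = det (H y)" for y
    by (simp add: matrix)
  \<comment> \<open>Only frontier points can be missed, and the frontier of a convex set is
    negligible.\<close>
  have "hull_sum - range moment_map \<subseteq> frontier hull_sum"
    using interior_hull_sum_subset closure_subset by (auto simp: frontier_def)
  then have "negligible (hull_sum - range moment_map)"
    using negligible_convex_frontier[OF convex_hull_sum] negligible_subset by blast
  moreover have "range moment_map - hull_sum = {}"
    using moment_map_in_hull_sum by auto
  ultimately have neg: "negligible ((hull_sum - range moment_map) \<union> (range moment_map - hull_sum))"
    by simp
  have "range moment_map \<in> lmeasurable" "measure lebesgue (range moment_map) = measure lebesgue hull_sum"
    using lmeasurable_negligible_symdiff[OF lmeasurable_compact[OF compact_hull_sum] neg]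
      measure_negligible_symdiff[OF lmeasurable_compact[OF compact_hull_sum] neg] by auto
  then have "((\<lambda>y. \<bar>det (matrix (f' y))\<bar>) has_integral measure lebesgue hull_sum) UNIV"
    using has_measure_differentiable_image[of UNIV moment_map f' "measure lebesgue hull_sum"]
      moment_map_has_derivative inj_moment_map by (simp add: f'_def[abs_def])
  then show ?thesis
    by (simp only: det_eq H_def)
qed

text \<open>All volumes are integrals over the same domain, so the alternating sum moves under the
  integral, where it is nonnegative at each \<open>y\<close>.\<close>

lemma alternating_hull_sum_measure_nonneg:
  fixes P :: "'i \<Rightarrow> (real^'n::{finite,wellorder}) set"
  assumes "finite M" "a \<notin> M"
    and "\<And>i. i \<in> insert a M \<Longrightarrow> finite (P i)"
    and "\<And>i. i \<in> insert a M \<Longrightarrow> interior (convex hull P i) \<noteq> {}"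
  shows "0 \<le> (\<Sum>I\<in>Pow M. (-1) ^ (card M - card I) *
    measure lebesgue (\<Sum>i\<in>insert a I. convex hull P i))"
proof (rule has_integral_nonneg)
  show "((\<lambda>y. \<Sum>I\<in>Pow M. (-1) ^ (card M - card I) *
      det (\<chi> r c. \<Sum>j\<in>Sigma (insert a I) P. fluctuation P y j $ r * fluctuation P y j $ c))
    has_integral (\<Sum>I\<in>Pow M. (-1) ^ (card M - card I) *
      measure lebesgue (\<Sum>i\<in>insert a I. convex hull P i))) UNIV"
  proof (intro has_integral_sum has_integral_mult_right hull_sum_has_integral)
    fix I assume "I \<in> Pow M"
    with assms show "polytope_family (insert a I) P"
      by (intro polytope_family.intro) (auto dest: finite_subset)
  qed (use \<open>finite M\<close> in simp)
qed (use assms in \<open>intro alternating_det_nonneg\<close>)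

section \<open>Approximation of convex bodies by polytopes\<close>

text \<open>A finite \<open>d\<close>-net \<open>N\<close> of \<open>C\<close> is thickened by a
  small cube, which contains the ball of radius \<open>d\<close>, so that \<open>C\<close> is
  covered, and is contained in the ball of radius \<open>e\<close>.\<close>

lemma polytope_outer_approximation:
  fixes C :: "'a::euclidean_space set"
  assumes "compact C" "convex C" "C \<noteq> {}" "0 < e"
  obtains P where "finite P" "interior (convex hull P) \<noteq> {}"
    "C \<subseteq> convex hull P" "convex hull P \<subseteq> C + cball 0 e"
proof -
  \<comment> \<open>Points of the cube with half-side \<open>d\<close> have l1 norm at most
    \<open>DIM('a) * d = e\<close>, which bounds their Euclidean norm.\<close>
  define d where "d = e / DIM('a)"
  have "d > 0"
    using \<open>0 < e\<close> by (simp add: d_def)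
  define u :: 'a where "u = (\<Sum>i\<in>Basis. d *\<^sub>R i)"
  have u: "u \<bullet> b = d" if "b \<in> Basis" for b
    using that by (simp add: u_def)
  obtain V where V: "finite V" "cbox (- u) u = convex hull V"
    using cube_convex_hull[OF \<open>d > 0\<close>, of "0 :: 'a"] by (metis add_0 diff_0 u_def)
  obtain N where N: "finite N" "N \<subseteq> C" "C \<subseteq> (\<Union>x\<in>N. ball x d)"
    using compactE_image[OF \<open>compact C\<close>, of C "\<lambda>x. ball x d"] \<open>d > 0\<close> by (metis UN_I centre_in_ball open_ball subsetI)
  have ball_V: "ball 0 d \<subseteq> convex hull V"
  proof
    fix z :: 'a assume "z \<in> ball 0 d"
    then have "\<bar>z \<bullet> b\<bar> \<le> d" if "b \<in> Basis" for b
      using Basis_le_norm[OF that, of z] by simp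
    then show "z \<in> convex hull V"
      by (fastforce simp: u mem_box abs_le_iff simp flip: V(2))
  qed
  have V_ball: "convex hull V \<subseteq> cball 0 e"
  proof
    fix z assume "z \<in> convex hull V"
    then have "z \<in> cbox (- u) u"
      by (simp add: V(2))
    then have "\<bar>z \<bullet> b\<bar> \<le> d" if "b \<in> Basis" for b
      using that by (auto simp: u mem_box abs_le_iff minus_le_iff dest: bspec[OF _ that])
    then have "(\<Sum>b\<in>Basis. \<bar>z \<bullet> b\<bar>) \<le> (\<Sum>b\<in>(Basis :: 'a set). d)"
      by (rule sum_mono)
    then show "z \<in> cball 0 e"
      using norm_le_l1[of z] by (simp add: d_def)
  qed
  have hull: "convex hull (N + V) = convex hull N + convex hull V"
    by (rule convex_hull_set_plus)
  have near: "ball x d \<subseteq> convex hull (N + V)" if "x \<in> N" for x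
  proof
    fix z assume "z \<in> ball x d"
    then have "z - x \<in> convex hull V"
      using ball_V by (auto simp: dist_norm norm_minus_commute)
    then have "x + (z - x) \<in> convex hull N + convex hull V"
      using that by (intro set_plus_intro) (auto intro: hull_inc)
    then show "z \<in> convex hull (N + V)"
      by (simp add: hull)
  qed
  show thesis
  proof
    show "finite (N + V)"
      using N V by (simp add: finite_set_plus)
    obtain x where "x \<in> N"
      using N \<open>C \<noteq> {}\<close> by blast
    then show "interior (convex hull (N + V)) \<noteq> {}"
      using near \<open>d > 0\<close> by (metis centre_in_ball empty_iff interior_maximal open_ball subsetD)
    show "C \<subseteq> convex hull (N + V)"
      using N near by blast
    show "convex hull (N + V) \<subseteq> C + cball 0 e"
      unfolding hull using V_ball hull_minimal[of N C convex] N(2) \<open>convex C\<close> by (intro set_plus_mono2)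
  qed
qed

text \<open>Outer regularity gives an open \<open>U\<close> around \<open>K0\<close> of small excess
  measure; by compactness \<open>U\<close> contains a uniform neighbourhood of \<open>K0\<close>,
  hence eventually every \<open>K n\<close>.\<close>

lemma measure_tendsto_outer:
  fixes K :: "nat \<Rightarrow> 'a::euclidean_space set"
  assumes "compact K0" and K: "\<And>n. compact (K n)" "\<And>n. K0 \<subseteq> K n" "\<And>n. K n \<subseteq> K0 + cball 0 (r n)"
    and "r \<longlonglongrightarrow> 0"
  shows "(\<lambda>n. measure lebesgue (K n)) \<longlonglongrightarrow> measure lebesgue K0"
proof (rule LIMSEQ_I)
  fix e :: real assume "0 < e"
  have meas: "K0 \<in> lmeasurable" "K n \<in> lmeasurable" for n
    using assms by (auto intro: lmeasurable_compact)
  obtain U where U: "open U" "K0 \<subseteq> U" "U - K0 \<in> lmeasurable" "emeasure lebesgue (U - K0) < ennreal e"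
    using sets_lebesgue_outer_open[OF fmeasurableD[OF meas(1)] \<open>0 < e\<close>] by metis
  have U_small: "measure lebesgue (U - K0) < e"
    using U(3,4) \<open>0 < e\<close> by (simp add: emeasure_eq_measure2 ennreal_less_iff)
  obtain d where "0 < d" and d: "(\<Union>x\<in>K0. cball x d) \<subseteq> U"
    using compact_subset_open_imp_cball_epsilon_subset[OF \<open>compact K0\<close> U(1,2)] by metis
  from \<open>r \<longlonglongrightarrow> 0\<close> \<open>0 < d\<close> obtain n0 where n0: "\<And>n. n \<ge> n0 \<Longrightarrow> \<bar>r n\<bar> < d"
    by (metis LIMSEQ_D diff_zero real_norm_def)
  have "norm (measure lebesgue (K n) - measure lebesgue K0) < e" if "n \<ge> n0" for n
  proof -
    have "K n \<subseteq> U"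
    proof
      fix z assume "z \<in> K n"
      then obtain x y where "x \<in> K0" "z = x + y" "norm y \<le> r n"
        using K(3)[of n] by (auto elim!: set_plus_elim)
      then have "z \<in> cball x d"
        using n0[OF that] by (simp add: dist_norm)
      then show "z \<in> U"
        using \<open>x \<in> K0\<close> d by blast
    qed
    then have "measure lebesgue (K n - K0) \<le> measure lebesgue (U - K0)"
      using meas U(3) by (intro measure_mono_fmeasurable) (auto intro: fmeasurable.Diff)
    moreover have "measure lebesgue (K n - K0) = measure lebesgue (K n) - measure lebesgue K0"
      using meas K(2) by (intro measurable_measure_Diff) auto
    ultimately show ?thesis
      using U_small measure_nonneg[of lebesgue "K n - K0"] by simp
  qed
  then show "\<exists>n0. \<forall>n\<ge>n0. norm (measure lebesgue (K n) - measure lebesgue K0) < e"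
    by blast
qed

section \<open>Minkowski sums of compact sets and passage to the limit\<close>

lemma compact_set_sum:
  fixes C :: "'i \<Rightarrow> 'a::real_normed_vector set"
  assumes "\<And>i. i \<in> L \<Longrightarrow> compact (C i)"
  shows "compact (\<Sum>i\<in>L. C i)"
  using assms
proof (induction L rule: infinite_finite_induct)
  case (insert i L)
  then show ?case
    using compact_sums[of "C i" "\<Sum>i\<in>L. C i"] by (simp add: set_plus_def Bex_def conj_ac)
qed simp_all

lemma set_sum_mono:
  assumes "\<And>i. i \<in> L \<Longrightarrow> A i \<subseteq> B i"
  shows "(\<Sum>i\<in>L. A i) \<subseteq> (\<Sum>i\<in>L. B i)"
  using assms by (induction L rule: infinite_finite_induct) (simp_all add: set_plus_mono2)

lemma set_sum_cball_subset:
  fixes L :: "'i set"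
  shows "(\<Sum>i\<in>L. cball (0 :: 'a::real_normed_vector) e) \<subseteq> cball 0 (of_nat (card L) * e)"
proof (induction L rule: infinite_finite_induct)
  case (insert i L)
  have "cball (0 :: 'a) e + cball 0 (of_nat (card L) * e) \<subseteq> cball 0 (of_nat (card (insert i L)) * e)"
    using insert(1,2) by (auto simp: distrib_right elim!: set_plus_elim intro!: order_trans[OF norm_triangle_ineq])
  moreover have "(\<Sum>i\<in>insert i L. cball (0 :: 'a) e) \<subseteq> cball 0 e + cball 0 (of_nat (card L) * e)"
    using insert by (simp add: set_plus_mono2)
  ultimately show ?case
    by (rule subset_trans[rotated])
qed auto

lemma alternating_set_sum_measure_nonneg_vec:
  fixes C :: "'i \<Rightarrow> (real^'n::{finite,wellorder}) set"
  assumes "finite M" "a \<notin> M"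
    and C: "\<And>i. i \<in> insert a M \<Longrightarrow> compact (C i)" "\<And>i. i \<in> insert a M \<Longrightarrow> convex (C i)"
      "\<And>i. i \<in> insert a M \<Longrightarrow> C i \<noteq> {}"
  shows "0 \<le> (\<Sum>I\<in>Pow M. (-1) ^ (card M - card I) * measure lebesgue (\<Sum>i\<in>insert a I. C i))"
proof -
  define e where "e n = 1 / real (Suc n)" for n
  have "\<exists>P. finite P \<and> interior (convex hull P) \<noteq> {} \<and> C i \<subseteq> convex hull P \<and> convex hull P \<subseteq> C i + cball 0 (e n)"
    if "i \<in> insert a M" for i n
    using polytope_outer_approximation[OF C[OF that], of "e n"] by (metis e_def of_nat_0_less_iff zero_less_Suc zero_less_divide_1_iff)
  \<comment> \<open>The polytopes are chosen independently of \<open>I\<close>, so for each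
    \<open>n\<close> the polytope inequality applies to the whole alternating sum.\<close>
  then obtain P where P: "\<And>i n. i \<in> insert a M \<Longrightarrow> finite (P i n)"
    "\<And>i n. i \<in> insert a M \<Longrightarrow> interior (convex hull P i n) \<noteq> {}"
    "\<And>i n. i \<in> insert a M \<Longrightarrow> C i \<subseteq> convex hull P i n"
    "\<And>i n. i \<in> insert a M \<Longrightarrow> convex hull P i n \<subseteq> C i + cball 0 (e n)"
    by metis
  have "e \<longlonglongrightarrow> 0"
    unfolding e_def using LIMSEQ_inverse_real_of_nat by (simp add: inverse_eq_divide)
  have "(\<lambda>n. measure lebesgue (\<Sum>i\<in>insert a I. convex hull P i n)) \<longlonglongrightarrow>
      measure lebesgue (\<Sum>i\<in>insert a I. C i)" if "I \<subseteq> M" for I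
  proof (rule measure_tendsto_outer)
    have sub: "i \<in> insert a M" if "i \<in> insert a I" for i
      using that \<open>I \<subseteq> M\<close> by auto
    show "compact (\<Sum>i\<in>insert a I. C i)"
      using C(1) sub by (intro compact_set_sum) blast
    fix n
    show "compact (\<Sum>i\<in>insert a I. convex hull P i n)"
      using P(1) sub by (intro compact_set_sum finite_imp_compact_convex_hull) blast
    show "(\<Sum>i\<in>insert a I. C i) \<subseteq> (\<Sum>i\<in>insert a I. convex hull P i n)"
      using P(3) sub by (intro set_sum_mono) blast
    have "(\<Sum>i\<in>insert a I. convex hull P i n) \<subseteq> (\<Sum>i\<in>insert a I. C i + cball 0 (e n))"
      using P(4) sub by (intro set_sum_mono) blast
    also have "\<dots> = (\<Sum>i\<in>insert a I. C i) + (\<Sum>i\<in>insert a I. cball 0 (e n))"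
      by (rule sum.distrib)
    also have "\<dots> \<subseteq> (\<Sum>i\<in>insert a I. C i) + cball 0 (of_nat (card (insert a I)) * e n)"
      by (intro set_plus_mono2 set_sum_cball_subset order_refl)
    finally show "(\<Sum>i\<in>insert a I. convex hull P i n) \<subseteq> \<dots>" .
  next
    show "(\<lambda>n. real (card (insert a I)) * e n) \<longlonglongrightarrow> 0"
      using tendsto_mult_right_zero[OF \<open>e \<longlonglongrightarrow> 0\<close>] by simp
  qed
  then have "(\<lambda>n. \<Sum>I\<in>Pow M. (-1) ^ (card M - card I) * measure lebesgue (\<Sum>i\<in>insert a I. convex hull P i n))
    \<longlonglongrightarrow> (\<Sum>I\<in>Pow M. (-1) ^ (card M - card I) * measure lebesgue (\<Sum>i\<in>insert a I. C i))"
    by (intro tendsto_sum tendsto_mult_left) auto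
  moreover have "0 \<le> (\<Sum>I\<in>Pow M. (-1) ^ (card M - card I) * measure lebesgue (\<Sum>i\<in>insert a I. convex hull P i n))" for n
    using alternating_hull_sum_measure_nonneg[OF assms(1,2) P(1,2)] .
  ultimately show ?thesis
    by (intro LIMSEQ_le_const) auto
qed

section \<open>Transfer to an arbitrary Euclidean space\<close>

text \<open>The change of variables theorem is available only on \<open>real^'n\<close> with \<open>'n\<close> finite and
  well-ordered, so the standard basis is turned into such an index type; its order is arbitrary.\<close>

typedef (overloaded) 'a basis_index = "Basis :: 'a::euclidean_space set"
  using nonempty_Basis by blast

lemma bij_betw_Rep_basis_index: "bij_betw Rep_basis_index UNIV (Basis :: 'a::euclidean_space set)"
  by (simp add: bij_betw_def inj_on_def Rep_basis_index_inject type_definition.Rep_range[OF type_definition_basis_index])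

instance basis_index :: (euclidean_space) finite
  by standard (use bij_betw_finite[OF bij_betw_Rep_basis_index] in simp)

definition basis_rank :: "'a::euclidean_space basis_index \<Rightarrow> nat" where
  "basis_rank = to_nat_on UNIV"

lemma basis_rank_inject: "basis_rank x = basis_rank y \<longleftrightarrow> x = y"
  unfolding basis_rank_def by (intro inj_on_eq_iff[OF inj_on_to_nat_on]) (simp_all add: countable_finite)

instantiation basis_index :: (euclidean_space) wellorder
begin

definition less_eq_basis_index :: "'a basis_index \<Rightarrow> 'a basis_index \<Rightarrow> bool" where
  "x \<le> y \<longleftrightarrow> basis_rank x \<le> basis_rank y"

definition less_basis_index :: "'a basis_index \<Rightarrow> 'a basis_index \<Rightarrow> bool" where
  "x < y \<longleftrightarrow> basis_rank x < basis_rank y"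

instance
proof
  fix P :: "'a basis_index \<Rightarrow> bool" and a
  assume "\<And>x. (\<And>y. y < x \<Longrightarrow> P y) \<Longrightarrow> P x"
  then show "P a"
    unfolding less_basis_index_def by (rule measure_induct_rule)
qed (auto simp: less_eq_basis_index_def less_basis_index_def basis_rank_inject)

end

section \<open>Coordinates in the standard basis and their effect on volume\<close>

definition coords :: "'a::euclidean_space \<Rightarrow> (real, 'a basis_index) vec" where
  "coords x = (\<chi> i. x \<bullet> Rep_basis_index i)"

definition of_coords :: "(real, 'a basis_index) vec \<Rightarrow> 'a::euclidean_space" where
  "of_coords v = (\<Sum>i\<in>UNIV. v $ i *\<^sub>R Rep_basis_index i)"

lemma of_coords_inner: "of_coords v \<bullet> Rep_basis_index i = v $ i"
proof -
  have "of_coords v \<bullet> Rep_basis_index i = (\<Sum>j\<in>UNIV. if j = i then v $ j else 0)"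
    unfolding of_coords_def inner_sum_left
    by (intro sum.cong) (auto simp: inner_Basis[OF Rep_basis_index Rep_basis_index] Rep_basis_index_inject)
  then show ?thesis
    by simp
qed

lemma coords_of_coords: "coords (of_coords v) = v"
  by (simp add: coords_def of_coords_inner)

lemma of_coords_coords: "of_coords (coords x) = x"
proof -
  have "of_coords (coords x) = (\<Sum>b\<in>Basis. (x \<bullet> b) *\<^sub>R b)"
    unfolding of_coords_def coords_def
    using sum.reindex_bij_betw[OF bij_betw_Rep_basis_index, of "\<lambda>b. (x \<bullet> b) *\<^sub>R b"] by simp
  then show ?thesis
    by (simp add: euclidean_representation)
qed

lemma linear_coords: "linear coords"
  by (intro linearI) (simp_all add: coords_def vec_eq_iff inner_add_left)

lemma compact_coords_image: "compact K \<Longrightarrow> compact (coords ` K)"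
  by (intro compact_continuous_image linear_continuous_on linear_coords[unfolded linear_conv_bounded_linear])

lemma of_coords_measurable: "of_coords \<in> borel_measurable borel"
  unfolding of_coords_def
  by (intro borel_measurable_continuous_onI continuous_intros)

text \<open>Lebesgue measure is determined by its values on boxes, and \<open>of_coords\<close>
  pulls boxes back to boxes with the same side lengths.\<close>

lemma lborel_eq_distr_of_coords: "lborel = distr lborel borel (of_coords :: _ \<Rightarrow> 'a::euclidean_space)"
proof (rule lborel_eqI)
  fix l u :: 'a assume le: "\<And>b. b \<in> Basis \<Longrightarrow> l \<bullet> b \<le> u \<bullet> b"
  have "of_coords -` box l u = box (coords l) (coords u)"
  proof -
    have "v \<in> of_coords -` box l u \<longleftrightarrow> v \<in> box (coords l) (coords u)" for v
    proof -
      have "v \<in> of_coords -` box l u \<longleftrightarrow> (\<forall>i. l \<bullet> Rep_basis_index i < v $ i \<and> v $ i < u \<bullet> Rep_basis_index i)"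
        unfolding vimage_eq mem_box of_coords_inner[symmetric]
        by (metis Rep_basis_index Rep_basis_index_cases)
      then show ?thesis
        by (simp add: mem_box Basis_vec_def inner_axis coords_def)
    qed
    then show ?thesis
      by blast
  qed
  then have "emeasure (distr lborel borel of_coords) (box l u) = emeasure lborel (box (coords l) (coords u))"
    by (simp add: emeasure_distr of_coords_measurable)
  also have "\<dots> = (\<Prod>b\<in>Basis. (coords u - coords l) \<bullet> b)"
    by (intro emeasure_lborel_box) (auto simp: Basis_vec_def inner_axis coords_def le[OF Rep_basis_index])
  also have "(\<Prod>b\<in>Basis. (coords u - coords l) \<bullet> b) = (\<Prod>i\<in>UNIV. (u - l) \<bullet> Rep_basis_index i)"
  proof -
    have "bij_betw (\<lambda>i. axis i 1) UNIV (Basis :: (real, 'a basis_index) vec set)"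
      by (auto simp: bij_betw_def inj_on_def axis_eq_axis Basis_vec_def)
    from prod.reindex_bij_betw[OF this, of "\<lambda>b. (coords u - coords l) \<bullet> b"] show ?thesis
      by (simp add: inner_axis coords_def inner_diff_left)
  qed
  also have "\<dots> = (\<Prod>b\<in>Basis. (u - l) \<bullet> b)"
    by (rule prod.reindex_bij_betw[OF bij_betw_Rep_basis_index])
  finally show "emeasure (distr lborel borel of_coords) (box l u) = (\<Prod>b\<in>Basis. (u - l) \<bullet> b)" .
qed simp

lemma measure_coords_image:
  fixes K :: "'a::euclidean_space set"
  assumes "compact K"
  shows "measure lebesgue (coords ` K) = measure lebesgue K"
proof -
  have coords_image: "coords ` K = of_coords -` K"
  proof (intro set_eqI iffI)
    fix v assume "v \<in> of_coords -` K"
    then show "v \<in> coords ` K"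
      by (intro image_eqI[where x = "of_coords v"]) (simp_all add: coords_of_coords)
  qed (auto simp: of_coords_coords)
  have "compact (coords ` K)"
    using assms by (rule compact_coords_image)
  \<comment> \<open>Compact sets are Borel, so the volume can be computed in \<open>lborel\<close>,
    where the pushforward identity applies.\<close>
  then have "measure lebesgue (coords ` K) = measure lborel (coords ` K)"
    by (intro measure_completion) (auto intro: borel_compact)
  also have "\<dots> = measure (distr lborel borel of_coords) K"
    using assms by (subst measure_distr) (auto simp: coords_image of_coords_measurable intro: borel_compact)
  also have "\<dots> = measure lebesgue K"
    using assms by (subst lborel_eq_distr_of_coords[symmetric], subst measure_completion) (auto intro: borel_compact)
  finally show ?thesis .
qed

text \<open>The linear map \<open>coords\<close> commutes with Minkowski sums and preserves the
  volume of compact sets, so the inequality carries over from coordinate space term by term.\<close>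

lemma alternating_set_sum_measure_nonneg:
  fixes C :: "'i \<Rightarrow> 'a::euclidean_space set"
  assumes "finite M" "a \<notin> M"
    and C: "\<And>i. i \<in> insert a M \<Longrightarrow> compact (C i)" "\<And>i. i \<in> insert a M \<Longrightarrow> convex (C i)"
      "\<And>i. i \<in> insert a M \<Longrightarrow> C i \<noteq> {}"
  shows "0 \<le> (\<Sum>I\<in>Pow M. (-1) ^ (card M - card I) * measure lebesgue (\<Sum>i\<in>insert a I. C i))"
proof -
  have "coords ` A + coords ` B = coords ` (A + B)" for A B :: "'a set"
  proof (intro equalityI subsetI)
    fix v assume "v \<in> coords ` A + coords ` B"
    then obtain x y where "x \<in> A" "y \<in> B" "v = coords (x + y)"
      by (auto elim!: set_plus_elim simp: linear_add[OF linear_coords])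
    then show "v \<in> coords ` (A + B)"
      by auto
  qed (auto elim!: set_plus_elim simp: linear_add[OF linear_coords] set_plus_intro)
  then have sum_image: "coords ` (\<Sum>i\<in>L. C i) = (\<Sum>i\<in>L. coords ` C i)" for L
    by (subst sum_set_linear) (auto simp: linear_0[OF linear_coords] o_def)
  have "measure lebesgue (\<Sum>i\<in>insert a I. C i) = measure lebesgue (\<Sum>i\<in>insert a I. coords ` C i)"
    if "I \<subseteq> M" for I
  proof -
    have "compact (\<Sum>i\<in>insert a I. C i)"
      using that C(1) by (intro compact_set_sum) blast
    then show ?thesis
      by (metis measure_coords_image sum_image)
  qed
  then have "(\<Sum>I\<in>Pow M. (-1) ^ (card M - card I) * measure lebesgue (\<Sum>i\<in>insert a I. C i)) =
      (\<Sum>I\<in>Pow M. (-1) ^ (card M - card I) * measure lebesgue (\<Sum>i\<in>insert a I. coords ` C i))"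
    by (intro sum.cong) auto
  also have "\<dots> \<ge> 0"
    using C
    by (intro alternating_set_sum_measure_nonneg_vec assms(1,2))
       (blast intro: compact_coords_image convex_linear_image[OF linear_coords])+
  finally show ?thesis .
qed

section \<open>Minkowski combinations\<close>

text \<open>As a sum in the commutative monoid of sets, a combination admits interchange of
  summation.\<close>

lemma minkowski_comb_eq_set_sum: "minkowski_comb k x B = (\<Sum>j<k. (*\<^sub>R) (x j) ` B j)"
proof (intro equalityI subsetI)
  fix y assume "y \<in> minkowski_comb k x B"
  then show "y \<in> (\<Sum>j<k. (*\<^sub>R) (x j) ` B j)"
    by (subst set_sum_alt) (auto simp: minkowski_comb_def)
next
  fix y assume "y \<in> (\<Sum>j<k. (*\<^sub>R) (x j) ` B j)"
  then obtain s where y: "y = (\<Sum>j<k. s j)" and s: "\<forall>j\<in>{..<k}. s j \<in> (*\<^sub>R) (x j) ` B j"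
    by (subst (asm) set_sum_alt) auto
  then obtain b where "\<forall>j\<in>{..<k}. b j \<in> B j \<and> s j = x j *\<^sub>R b j"
    unfolding image_iff by metis
  then show "y \<in> minkowski_comb k x B"
    by (auto simp: minkowski_comb_def y intro!: exI[of _ b])
qed

text \<open>Convexity gives the inclusion from right to left: if \<open>s + t\<close> is positive, a
  sum of scaled points of \<open>B\<close> is \<open>s + t\<close> times a convex combination of
  them.\<close>

lemma convex_scaleR_add:
  fixes B :: "'a::real_vector set"
  assumes "convex B" "0 \<le> s" "0 \<le> t"
  shows "(*\<^sub>R) (s + t) ` B = (*\<^sub>R) s ` B + (*\<^sub>R) t ` B"
proof (intro equalityI subsetI)
  fix y assume "y \<in> (*\<^sub>R) s ` B + (*\<^sub>R) t ` B"
  then obtain b c where bc: "b \<in> B" "c \<in> B" "y = s *\<^sub>R b + t *\<^sub>R c"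
    by (auto elim!: set_plus_elim)
  show "y \<in> (*\<^sub>R) (s + t) ` B"
  proof (cases "s + t = 0")
    case True
    then have "s = 0" "t = 0"
      using assms by auto
    then show ?thesis
      using bc by auto
  next
    case False
    then have "(s / (s + t)) *\<^sub>R b + (t / (s + t)) *\<^sub>R c \<in> B"
      using assms bc by (intro convexD) (auto simp flip: add_divide_distrib)
    moreover have "y = (s + t) *\<^sub>R ((s / (s + t)) *\<^sub>R b + (t / (s + t)) *\<^sub>R c)"
      using False bc by (simp add: scaleR_add_right)
    ultimately show ?thesis
      by (rule rev_image_eqI)
  qed
qed (auto simp: scaleR_add_left intro!: set_plus_intro)

lemma convex_scaleR_sum:
  fixes B :: "'a::real_vector set"
  assumes "finite L" "convex B" "B \<noteq> {}" "\<And>i. i \<in> L \<Longrightarrow> 0 \<le> z i"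
  shows "(*\<^sub>R) (\<Sum>i\<in>L. z i) ` B = (\<Sum>i\<in>L. (*\<^sub>R) (z i) ` B)"
  using assms(1,4)
proof induction
  case empty
  \<comment> \<open>The empty sum of sets is \<open>{0}\<close>, and scaling by zero gives
    \<open>{0}\<close> only for nonempty \<open>B\<close>.\<close>
  then show ?case
    using \<open>B \<noteq> {}\<close> by auto
next
  case (insert i L)
  then show ?case
    by (simp add: convex_scaleR_add[OF \<open>convex B\<close>] sum_nonneg)
qed

lemma minkowski_comb_sum:
  assumes "finite L" "\<And>j. j < k \<Longrightarrow> convex (B j)" "\<And>j. j < k \<Longrightarrow> B j \<noteq> {}"
    and "\<And>i. i \<in> L \<Longrightarrow> nonneg_vec k (z i)"
  shows "minkowski_comb k (\<lambda>j. \<Sum>i\<in>L. z i j) B = (\<Sum>i\<in>L. minkowski_comb k (z i) B)"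
proof -
  have "minkowski_comb k (\<lambda>j. \<Sum>i\<in>L. z i j) B = (\<Sum>j<k. \<Sum>i\<in>L. (*\<^sub>R) (z i j) ` B j)"
    unfolding minkowski_comb_eq_set_sum
    using assms by (intro sum.cong refl convex_scaleR_sum) (auto simp: nonneg_vec_def)
  also have "\<dots> = (\<Sum>i\<in>L. minkowski_comb k (z i) B)"
    unfolding minkowski_comb_eq_set_sum by (rule sum.swap)
  finally show ?thesis .
qed

lemma minkowski_comb_cong:
  "(\<And>j. j < k \<Longrightarrow> x j = y j) \<Longrightarrow> minkowski_comb k x B = minkowski_comb k y B"
  unfolding minkowski_comb_eq_set_sum by (intro sum.cong) auto

text \<open>Disjoint supports leave at most one positive \<open>xs i j\<close> at the coordinate
  \<open>j\<close>. As \<open>x0 j\<close> is nonnegative, at most one increment is nonzero, and it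
  is the excess of the maximum over \<open>x0 j\<close>.\<close>

lemma join_vec_eq_sum:
  assumes "finite I" "0 \<le> x0 j" "\<And>i. i \<in> I \<Longrightarrow> 0 \<le> xs i j"
    and disj: "\<And>i l. i \<in> I \<Longrightarrow> l \<in> I \<Longrightarrow> i \<noteq> l \<Longrightarrow> min (xs i j) (xs l j) = 0"
  shows "join_vec x0 xs I j = x0 j + (\<Sum>i\<in>I. max 0 (xs i j - x0 j))"
proof (cases "\<exists>i\<in>I. x0 j < xs i j")
  case True
  then obtain i where i: "i \<in> I" "x0 j < xs i j"
    by blast
  have zero: "xs l j = 0" if "l \<in> I" "l \<noteq> i" for l
    using disj[of l i] that i assms(2) by (auto simp: min_def split: if_splits)
  have "join_vec x0 xs I j = xs i j"
    unfolding join_vec_def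
  proof (rule Max_eqI)
    show "y \<le> xs i j" if "y \<in> insert (x0 j) ((\<lambda>i. xs i j) ` I)" for y
      using that i zero assms(2) by fastforce
  qed (use i \<open>finite I\<close> in auto)
  moreover have "(\<Sum>l\<in>I. max 0 (xs l j - x0 j)) = (\<Sum>l\<in>I. if l = i then xs i j - x0 j else 0)"
    using i zero assms(2) by (intro sum.cong) (auto simp: max_def)
  ultimately show ?thesis
    using i \<open>finite I\<close> by simp
next
  case False
  then have "join_vec x0 xs I j = x0 j"
    unfolding join_vec_def using \<open>finite I\<close> by (intro Max_eqI) (auto simp: not_less)
  moreover have "(\<Sum>i\<in>I. max 0 (xs i j - x0 j)) = 0"
    using False by (intro sum.neutral) (auto simp: max_def not_less)
  ultimately show ?thesis
    by simp
qed

section \<open>Supermodularity of volume from nonnegative mixed differences\<close>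

theorem theorem3p6:
  fixes B :: "nat \<Rightarrow> 'a::euclidean_space set" and k :: nat
  assumes "\<And>i. i < k \<Longrightarrow> compact (B i)"
      and "\<And>i. i < k \<Longrightarrow> convex (B i)"
  shows "\<forall>m\<ge>1. m_supermodular k m (\<lambda>x. measure lebesgue (minkowski_comb k x B))"
proof (cases "\<exists>i<k. B i = {}")
  \<comment> \<open>With an empty body every combination is empty, so all volumes are zero.\<close>
  case True
  then have "minkowski_comb k x B = {}" for x
    by (auto simp: minkowski_comb_def)
  then show ?thesis
    by (simp add: m_supermodular_def)
next
  case False
  then have nonempty: "B i \<noteq> {}" if "i < k" for i
    using that by blast
  show ?thesis
    unfolding m_supermodular_def
  proof (intro allI impI)
    fix m :: nat and x0 :: "nat \<Rightarrow> real" and xs :: "nat \<Rightarrow> nat \<Rightarrow> real"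
    assume x0: "nonneg_vec k x0" and xs: "\<forall>i\<in>{1..m}. nonneg_vec k (xs i)"
      and disj: "\<forall>i\<in>{1..m}. \<forall>l\<in>{1..m}. i < l \<longrightarrow> (\<forall>j<k. min (xs i j) (xs l j) = 0)"
    \<comment> \<open>The index \<open>0\<close> lies outside \<open>{1..m}\<close> and can
      therefore carry the base point \<open>x0\<close>; the other indices carry the increments over
      it.\<close>
    define z where "z i = (if i = 0 then x0 else (\<lambda>j. max 0 (xs i j - x0 j)))" for i
    have z: "nonneg_vec k (z i)" for i
      using x0 by (auto simp: z_def nonneg_vec_def)
    have comb: "minkowski_comb k (join_vec x0 xs I) B = (\<Sum>i\<in>insert 0 I. minkowski_comb k (z i) B)"
      if I: "I \<subseteq> {1..m}" for I
    proof -
      have fin: "finite I" and "0 \<notin> I"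
        using I by (auto dest: finite_subset)
      have "join_vec x0 xs I j = (\<Sum>i\<in>insert 0 I. z i j)" if "j < k" for j
      proof -
        have "min (xs i j) (xs l j) = 0" if "i \<in> I" "l \<in> I" "i \<noteq> l" for i l
          using disj I that \<open>j < k\<close> by (metis linorder_neqE_nat min.commute subsetD)
        then have "join_vec x0 xs I j = x0 j + (\<Sum>i\<in>I. max 0 (xs i j - x0 j))"
          using x0 xs I fin that by (intro join_vec_eq_sum) (auto simp: nonneg_vec_def)
        also have "\<dots> = (\<Sum>i\<in>insert 0 I. z i j)"
          using fin \<open>0 \<notin> I\<close> by (auto simp: z_def intro!: sum.cong)
        finally show ?thesis .
      qed
      then have "minkowski_comb k (join_vec x0 xs I) B = minkowski_comb k (\<lambda>j. \<Sum>i\<in>insert 0 I. z i j) B"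
        by (rule minkowski_comb_cong)
      also have "\<dots> = (\<Sum>i\<in>insert 0 I. minkowski_comb k (z i) B)"
        using fin assms nonempty z by (intro minkowski_comb_sum) auto
      finally show ?thesis .
    qed
    have "0 \<le> (\<Sum>I\<in>Pow {1..m}. (-1) ^ (card {1..m} - card I) *
        measure lebesgue (\<Sum>i\<in>insert 0 I. minkowski_comb k (z i) B))"
    proof (rule alternating_set_sum_measure_nonneg)
      fix i
      show "compact (minkowski_comb k (z i) B)"
        unfolding minkowski_comb_eq_set_sum using assms by (intro compact_set_sum compact_scaling) auto
      show "convex (minkowski_comb k (z i) B)"
        unfolding minkowski_comb_eq_set_sum using assms by (intro convex_set_sum convex_scaling) auto
      show "minkowski_comb k (z i) B \<noteq> {}"
        using nonempty by (auto simp: minkowski_comb_def intro!: exI[of _ "\<lambda>j. SOME b. b \<in> B j"] some_in_eq[THEN iffD2])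
    qed auto
    then show "0 \<le> (\<Sum>I\<in>Pow {1..m}. (-1) ^ (m - card I) * measure lebesgue (minkowski_comb k (join_vec x0 xs I) B))"
      by (simp add: comb)
  qed
qed

end
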